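(* Let $\mathcal{X}$ be a separable Banach space with a Borel probability measure $\mu_0$ (the prior), let $\mathcal{Y}=\mathbb{R}^p$, and let $\mathcal{D}$ be a metric space. For $d\in\mathcal{D}$ let $\pi(\cdot|x;d)$ be a likelihood density and, for $N\in\mathbb{N}$, let $\pi_N(\cdot|x;d)$ be a surrogate likelihood density, with evidences $\pi(y;d)=\int_{\mathcal{X}}\pi(y|x;d)\,d\mu_0(x)$ and $\pi_N(y;d)=\int_{\mathcal{X}}\pi_N(y|x;d)\,d\mu_0(x)$. Define $$U(d)=\int_{\mathcal{Y}}\int_{\mathcal{X}}\log\left(\frac{\pi(y|x;d)}{\pi(y;d)}\right)\pi(y|x;d)\,d\mu_0(x)\,dy,\qquad U_N(d)=\int_{\mathcal{Y}}\int_{\mathcal{X}}\log\left(\frac{\pi_N(y|x;d)}{\pi_N(y;d)}\right)\pi_N(y|x;d)\,d\mu_0(x)\,dy.$$ Assume: (A1) There exist $C_1>0$ and a function $\psi:\mathbb{N}\to\mathbb{R}_+$ with $\psi(N)\to0$ as $N\to\infty$ such that for all $d\in\mathcal{D}$ and all $N\in\mathbb{N}$, $$\mathbb{E}^{\mu_0}\left[D_{\mathrm{KL}}\left(\pi_N(\cdot|X;d)\,\|\,\pi(\cdot|X;d)\right)\right]\le C_1\psi(N).$$ (A3) There exists $C_0>0$ such that for every $N\in\mathbb{N}$, every $d\in\mathcal{D}$ and every sequence $d_N\to d$ in $\mathcal{D}$, $$\int_{\mathcal{Y}}\int_{\mathcal{X}}\log^2\left(\frac{\pi(y|x;d)}{\pi(y;d)}\right)\left[\pi(y|x;d)+\pi_N(y|x;d)+\pi(y|x;d_N)\right]d\mu_0(x)\,dy<C_0.$$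 Then there exists $C>0$ such that for all $N$ sufficiently large, $$\sup_{d\in\mathcal{D}}|U(d)-U_N(d)|\le C\sqrt{\psi(N)}.$$
   Context: A likelihood density $\pi(\cdot|x;d)$ is, for each $x\in\mathcal{X}$ and $d\in\mathcal{D}$, a probability density on $\mathbb{R}^p$ with respect to Lebesgue measure $dy$, jointly measurable in $(x,y)$; likewise for the surrogates. $\mathbb{E}^{\mu_0}$ denotes expectation over $X\sim\mu_0$. For probability densities $q,r$ on $\mathbb{R}^p$, $D_{\mathrm{KL}}(q\,\|\,r)=\int\log(q/r)\,q\,dy\in[0,\infty]$ is the Kullback--Leibler divergence, equal to $+\infty$ if $q\,dy$ is not absolutely continuous with respect to $r\,dy$. Conventions: an integrand is $0$ wherever the density (or sum of densities) multiplying the logarithm or squared logarithm vanishes, and $\log^2$ of a ratio with zero numerator is $+\infty$ where the multiplying density is positive. *)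

theory Defs
  imports "HOL-Probability.Probability"
begin

definition likelihood_density :: "('x::topological_space \<Rightarrow> 'y::euclidean_space \<Rightarrow> real) \<Rightarrow> bool" where
  "likelihood_density f \<longleftrightarrow>
     (\<lambda>(x, y). f x y) \<in> borel_measurable (borel \<Otimes>\<^sub>M borel) \<and>
     (\<forall>x y. 0 \<le> f x y) \<and>
     (\<forall>x. (\<integral>\<^sup>+ y. ennreal (f x y) \<partial>lborel) = 1)"

definition evidence :: "'x measure \<Rightarrow> ('x \<Rightarrow> 'y \<Rightarrow> real) \<Rightarrow> 'y \<Rightarrow> ennreal" where
  "evidence \<mu> f y = (\<integral>\<^sup>+ x. ennreal (f x y) \<partial>\<mu>)"

text \<open>Quotients of densities are formed in the extended nonnegative reals, where
  \<open>0 / 0 = 0\<close> and \<open>a / 0 = \<infinity>\<close> for \<open>a > 0\<close>; hence a ratio with zero numerator has logarithm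
  \<open>-\<infinity>\<close> and squared logarithm \<open>\<infinity>\<close>.\<close>

definition ext_ln :: "ennreal \<Rightarrow> ereal" where
  "ext_ln t = (if t = 0 then - \<infinity> else if t = \<infinity> then \<infinity> else ereal (ln (enn2real t)))"

text \<open>The integral of an extended real function as the integral of its positive part minus that
  of its negative part (\<open>e2ennreal\<close> sends negative values to \<open>0\<close>). If both are infinite, the
  value is \<open>\<infinity> - \<infinity> = \<infinity>\<close>, never a finite number.\<close>

definition ext_integral :: "'a measure \<Rightarrow> ('a \<Rightarrow> ereal) \<Rightarrow> ereal" where
  "ext_integral M f =
     enn2ereal (\<integral>\<^sup>+ z. e2ennreal (f z) \<partial>M) - enn2ereal (\<integral>\<^sup>+ z. e2ennreal (- f z) \<partial>M)"

text \<open>In \<open>KL_div\<close>, \<open>expected_utility\<close> and \<open>log_sq_moment\<close>, the convention that an integrand is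
  \<open>0\<close> wherever the density multiplying the logarithm vanishes is \<open>\<plusminus>\<infinity> * 0 = 0\<close>, which holds both
  in \<open>ereal\<close> and in \<open>ennreal\<close>. For probability densities the integral in \<open>KL_div\<close> is
  nonnegative, so that \<open>e2ennreal\<close> only changes its type. The library's \<open>KL_divergence\<close> is
  real-valued and cannot express the value \<open>\<infinity>\<close>.\<close>

definition KL_div :: "('y::euclidean_space \<Rightarrow> real) \<Rightarrow> ('y \<Rightarrow> real) \<Rightarrow> ennreal" where
  "KL_div q r =
     (if absolutely_continuous (density lborel (\<lambda>y. ennreal (r y))) (density lborel (\<lambda>y. ennreal (q y)))
      then e2ennreal (ext_integral lborel (\<lambda>y. ext_ln (ennreal (q y) / ennreal (r y)) * ereal (q y)))
      else \<infinity>)"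

definition expected_utility :: "'x measure \<Rightarrow> ('x \<Rightarrow> 'y::euclidean_space \<Rightarrow> real) \<Rightarrow> ereal" where
  "expected_utility \<mu> f =
     ext_integral lborel (\<lambda>y. ext_integral \<mu> (\<lambda>x.
       ext_ln (ennreal (f x y) / evidence \<mu> f y) * ereal (f x y)))"

definition log_sq_moment ::
    "'x measure \<Rightarrow> ('x \<Rightarrow> 'y::euclidean_space \<Rightarrow> real) \<Rightarrow> ('x \<Rightarrow> 'y \<Rightarrow> real) \<Rightarrow> ennreal" where
  "log_sq_moment \<mu> f w =
     (\<integral>\<^sup>+ y. (\<integral>\<^sup>+ x.
        e2ennreal ((ext_ln (ennreal (f x y) / evidence \<mu> f y))\<^sup>2) * ennreal (w x y) \<partial>\<mu>) \<partial>lborel)"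

end

theory Submission
  imports Defs
begin

text \<open>Write \<open>f = \<pi>(y|x;d)\<close>, \<open>g = \<pi>\<^sub>N(y|x;d)\<close> with evidences \<open>p\<close>, \<open>q\<close>. Integrating over \<open>\<mu>\<^sub>0 \<otimes> dy\<close>,
  the difference \<open>U\<^sub>N - U\<close> equals \<open>\<integral> g log (g/f) - \<integral> g log (q/p) + \<integral> (g - f) log (f/p)\<close>.
  The first term is the expected divergence, and the second, the divergence of the evidences, lies
  between \<open>0\<close> and the first. By Cauchy--Schwarz the third is at most
  \<open>(\<integral> (\<surd>g - \<surd>f)\<^sup>2)\<^sup>1\<^sup>/\<^sup>2 (\<integral> (\<surd>g + \<surd>f)\<^sup>2 log\<^sup>2 (f/p))\<^sup>1\<^sup>/\<^sup>2\<close>, where the Hellinger integral is bounded by the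
  divergence and the other factor by (A3).\<close>

section \<open>Extended-valued integrals and Bochner integrals\<close>

lemma ext_integral_cong_AE:
  assumes "AE z in M. f z = g z"
  shows "ext_integral M f = ext_integral M g"
proof -
  have "(\<integral>\<^sup>+ z. e2ennreal (f z) \<partial>M) = (\<integral>\<^sup>+ z. e2ennreal (g z) \<partial>M)"
    and "(\<integral>\<^sup>+ z. e2ennreal (- f z) \<partial>M) = (\<integral>\<^sup>+ z. e2ennreal (- g z) \<partial>M)"
    using assms by (auto intro!: nn_integral_cong_AE)
  then show ?thesis
    by (simp add: ext_integral_def)
qed

lemma ext_integral_integrable:
  assumes "integrable M f"
  shows "ext_integral M (\<lambda>z. ereal (f z)) = ereal (integral\<^sup>L M f)"
proof -
  have [simp]: "enn2ereal P = ereal (enn2real P)" if "P \<noteq> \<infinity>" for P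
    using that by (cases P) auto
  show ?thesis
    using assms by (simp add: ext_integral_def real_lebesgue_integral_def real_integrable_def)
qed

section \<open>Logarithmic inequalities and Cauchy-Schwarz\<close>

text \<open>This is \<open>ln t \<le> t - 1\<close> at \<open>t = b / a\<close>, multiplied by
  \<open>a\<close>. The last hypothesis excludes \<open>b = 0 < a\<close>, where
  \<open>ln (a / 0) = 0\<close> would make the claim false.\<close>

lemma mult_ln_div_ge:
  fixes a b :: real
  assumes "0 \<le> a" "0 \<le> b" "b = 0 \<Longrightarrow> a = 0"
  shows "a - b \<le> a * ln (a / b)"
proof (cases "a = 0")
  case False
  with assms have ab: "0 < a" "0 < b" by force+
  have "ln (b / a) \<le> b / a - 1"
    using ab by (intro ln_le_minus_one) simp
  then have "a * ln (b / a) \<le> a * (b / a - 1)"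
    using ab by (intro mult_left_mono) auto
  also have "\<dots> = b - a"
    using ab by (simp add: field_simps)
  finally show ?thesis
    using ab by (simp add: ln_div algebra_simps)
qed (use assms in auto)

text \<open>Pointwise form of the bound of the squared Hellinger distance by the divergence.
  \<open>mult_ln_div_ge\<close> at the square roots, multiplied by \<open>2 * sqrt a\<close>, gives
  \<open>2 * a - 2 * sqrt a * sqrt b \<le> a * ln (a / b)\<close>.\<close>

lemma sqrt_diff_sq_le_mult_ln_div:
  fixes a b :: real
  assumes "0 \<le> a" "0 \<le> b" "b = 0 \<Longrightarrow> a = 0"
  shows "(sqrt a - sqrt b)\<^sup>2 \<le> a * ln (a / b) - a + b"
proof (cases "a = 0")
  case False
  with assms have ab: "0 < a" "0 < b" by force+
  have "sqrt a * sqrt a - sqrt a * sqrt b \<le> sqrt a * sqrt a * ln (sqrt a / sqrt b)"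
    using mult_left_mono[OF mult_ln_div_ge[of "sqrt a" "sqrt b"], of "sqrt a"] ab
    by (simp add: right_diff_distrib mult.assoc[symmetric])
  also have "\<dots> = a * ln (a / b) / 2"
    using ab by (simp add: ln_div ln_sqrt diff_divide_distrib[symmetric])
  finally show ?thesis
    using ab by (simp add: power2_eq_square algebra_simps)
qed (use assms in auto)

lemma Cauchy_Schwarz_integral:
  fixes u v :: "'a \<Rightarrow> real"
  assumes [measurable]: "u \<in> borel_measurable M" "v \<in> borel_measurable M"
    and u: "integrable M (\<lambda>z. (u z)\<^sup>2)" and v: "integrable M (\<lambda>z. (v z)\<^sup>2)"
  shows "\<bar>\<integral>z. u z * v z \<partial>M\<bar> \<le> sqrt (\<integral>z. (u z)\<^sup>2 \<partial>M) * sqrt (\<integral>z. (v z)\<^sup>2 \<partial>M)"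
proof (cases "(\<integral>z. (u z)\<^sup>2 \<partial>M) = 0 \<or> (\<integral>z. (v z)\<^sup>2 \<partial>M) = 0")
  case True
  then have "AE z in M. u z * v z = 0"
    using integral_nonneg_eq_0_iff_AE[OF u] integral_nonneg_eq_0_iff_AE[OF v] by auto
  then have "(\<integral>z. u z * v z \<partial>M) = 0"
    by (rule integral_eq_zero_AE)
  then show ?thesis by simp
next
  case False
  define A where "A = (\<integral>z. (u z)\<^sup>2 \<partial>M)"
  define B where "B = (\<integral>z. (v z)\<^sup>2 \<partial>M)"
  have AB: "0 < A" "0 < B"
    using False by (auto simp: A_def B_def less_le)
  \<comment> \<open>This weight minimises \<open>(t * A + B / t) / 2\<close>, the integral of the
    pointwise mean inequality below; the minimum is \<open>sqrt A * sqrt B\<close>.\<close>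
  define t where "t = sqrt B / sqrt A"
  have t: "0 < t" using AB by (simp add: t_def)
  have bound: "\<bar>u z * v z\<bar> \<le> (t * (u z)\<^sup>2 + (v z)\<^sup>2 / t) / 2" for z
  proof -
    have "0 \<le> (t * \<bar>u z\<bar> - \<bar>v z\<bar>)\<^sup>2 / t"
      using t by simp
    also have "\<dots> = t * (u z)\<^sup>2 + (v z)\<^sup>2 / t - 2 * \<bar>u z * v z\<bar>"
      using t by (simp add: power2_diff power_mult_distrib abs_mult field_simps) (simp add: power2_eq_square)
    finally show ?thesis by simp
  qed
  have "\<bar>\<integral>z. u z * v z \<partial>M\<bar> \<le> (\<integral>z. (t * (u z)\<^sup>2 + (v z)\<^sup>2 / t) / 2 \<partial>M)"
  proof -
    have "integrable M (\<lambda>z. u z * v z)"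
    proof (rule Bochner_Integration.integrable_bound)
      show "integrable M (\<lambda>z. (t * (u z)\<^sup>2 + (v z)\<^sup>2 / t) / 2)"
        using u v by simp
      show "AE z in M. norm (u z * v z) \<le> norm ((t * (u z)\<^sup>2 + (v z)\<^sup>2 / t) / 2)"
        unfolding real_norm_def by (intro AE_I2 order_trans[OF bound] abs_ge_self)
    qed simp
    then have "integrable M (\<lambda>z. \<bar>u z * v z\<bar>)" by simp
    with bound have "(\<integral>z. \<bar>u z * v z\<bar> \<partial>M) \<le> (\<integral>z. (t * (u z)\<^sup>2 + (v z)\<^sup>2 / t) / 2 \<partial>M)"
      by (intro integral_mono) (use u v in auto)
    with integral_abs_bound[of M "\<lambda>z. u z * v z"] show ?thesis by linarith
  qed
  also have "\<dots> = (t * A + B / t) / 2"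
    using u v by (simp add: A_def B_def)
  also have "\<dots> = sqrt A * sqrt B"
  proof -
    have "t * A = sqrt B * (A / sqrt A)"
      by (simp add: t_def)
    also have "\<dots> = sqrt A * sqrt B"
      using AB by (simp only: real_div_sqrt less_imp_le mult.commute)
    finally have "t * A = sqrt A * sqrt B" .
    moreover have "B / t = sqrt A * (B / sqrt B)"
      by (simp add: t_def)
    then have "B / t = sqrt A * sqrt B"
      using AB by (simp only: real_div_sqrt less_imp_le)
    ultimately show ?thesis by simp
  qed
  finally show ?thesis by (simp add: A_def B_def)
qed

section \<open>Divergence as the integral of a nonnegative function\<close>

text \<open>Unlike \<^const>\<open>KL_div\<close>, the integrand on the left is evidently measurable in parameters,
  which permits Tonelli's theorem without a measurability proof for \<^const>\<open>KL_div\<close>.\<close>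
lemma nn_integral_le_KL_div:
  fixes q r :: "'y::euclidean_space \<Rightarrow> real"
  assumes [measurable]: "q \<in> borel_measurable borel" "r \<in> borel_measurable borel"
    and nonneg: "\<And>y. 0 \<le> q y" "\<And>y. 0 \<le> r y"
    and q1: "(\<integral>\<^sup>+ y. ennreal (q y) \<partial>lborel) = 1" and r1: "(\<integral>\<^sup>+ y. ennreal (r y) \<partial>lborel) = 1"
  shows "(\<integral>\<^sup>+ y. (if r y = 0 \<and> q y \<noteq> 0 then \<infinity> else ennreal (q y * ln (q y / r y) - q y + r y)) \<partial>lborel)
    \<le> KL_div q r"
proof (cases "KL_div q r = \<infinity>")
  case False
  let ?E = "\<lambda>y. ext_ln (ennreal (q y) / ennreal (r y)) * ereal (q y)"
  let ?L = "\<lambda>y. q y * ln (q y / r y)"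
  have ac: "absolutely_continuous (density lborel (\<lambda>y. ennreal (r y))) (density lborel (\<lambda>y. ennreal (q y)))"
    and KL: "KL_div q r = e2ennreal (ext_integral lborel ?E)"
    using False by (auto simp: KL_div_def split: if_splits)
  \<comment> \<open>The zero set of \<open>r\<close> is null for the measure with density
    \<open>r\<close>, so absolute continuity makes it null for the one with density
    \<open>q\<close>.\<close>
  have "AE y in density lborel (\<lambda>y. ennreal (r y)). r y \<noteq> 0"
    by (subst AE_density) (auto simp: less_le)
  then have "AE y in density lborel (\<lambda>y. ennreal (q y)). r y \<noteq> 0"
    by (rule absolutely_continuous_AE[rotated 2]) (use ac in auto)
  then have supp: "AE y in lborel. r y = 0 \<longrightarrow> q y = 0"
    by (subst (asm) AE_density) (use nonneg in \<open>auto simp: less_le\<close>)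
  have int: "integrable lborel q" "integrable lborel r"
    using q1 r1 nonneg by (auto intro!: integrableI_nonneg)
  have int1: "integral\<^sup>L lborel q = 1" "integral\<^sup>L lborel r = 1"
    using q1 r1 nonneg by (auto simp: integral_eq_nn_integral)
  have "AE y in lborel. ?E y = ereal (?L y)"
    using supp
  proof eventually_elim
    case (elim y)
    show ?case
    proof (cases "q y = 0")
      case False
      with elim nonneg[of y] have "0 < q y" "0 < r y" by (auto simp: less_le)
      then show ?thesis
        by (simp add: ext_ln_def divide_ennreal mult.commute)
    qed (simp add: zero_ereal_def[symmetric])
  qed
  then have E: "ext_integral lborel ?E = ext_integral lborel (\<lambda>y. ereal (?L y))"
    by (rule ext_integral_cong_AE)
  \<comment> \<open>Since \<open>?L \<ge> q - r\<close>, the negative part of \<open>?L\<close> is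
    dominated by \<open>r\<close>. Integrability can then fail only through an infinite positive
    part, which would make the divergence infinite.\<close>
  have "(\<integral>\<^sup>+ y. ennreal (- ?L y) \<partial>lborel) \<le> (\<integral>\<^sup>+ y. ennreal (r y) \<partial>lborel)"
  proof (rule nn_integral_mono_AE)
    show "AE y in lborel. ennreal (- ?L y) \<le> ennreal (r y)"
      using supp
    proof eventually_elim
      case (elim y)
      show ?case
        using mult_ln_div_ge[of "q y" "r y"] elim nonneg[of y] by (intro ennreal_leI) auto
    qed
  qed
  with r1 have neg: "(\<integral>\<^sup>+ y. ennreal (- ?L y) \<partial>lborel) < \<infinity>"
    by (auto simp: less_top[symmetric] top_unique)
  have pos: "(\<integral>\<^sup>+ y. ennreal (?L y) \<partial>lborel) \<noteq> \<infinity>"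
  proof
    assume "(\<integral>\<^sup>+ y. ennreal (?L y) \<partial>lborel) = \<infinity>"
    then have "ext_integral lborel (\<lambda>y. ereal (?L y)) = \<infinity>"
      by (simp add: ext_integral_def)
    with False show False by (simp add: KL E)
  qed
  have L: "integrable lborel ?L"
    using neg pos by (auto simp: real_integrable_def)
  have "(\<integral>\<^sup>+ y. (if r y = 0 \<and> q y \<noteq> 0 then \<infinity> else ennreal (q y * ln (q y / r y) - q y + r y)) \<partial>lborel)
    = (\<integral>\<^sup>+ y. ennreal (?L y - q y + r y) \<partial>lborel)"
    using supp by (intro nn_integral_cong_AE) auto
  also have "\<dots> = ennreal (\<integral> y. ?L y - q y + r y \<partial>lborel)"
  proof (intro nn_integral_eq_integral)
    show "AE y in lborel. 0 \<le> ?L y - q y + r y"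
      using supp
    proof eventually_elim
      case (elim y)
      then show ?case
        using mult_ln_div_ge[of "q y" "r y"] nonneg[of y] by auto
    qed
  qed (use L int in auto)
  \<comment> \<open>The corrections \<open>- q y + r y\<close> made the integrand nonnegative; they
    cancel here because both densities have mass 1.\<close>
  also have "(\<integral> y. ?L y - q y + r y \<partial>lborel) = integral\<^sup>L lborel ?L"
    using L int int1 by simp
  also have "ennreal (integral\<^sup>L lborel ?L) = KL_div q r"
    by (simp add: KL E ext_integral_integrable[OF L])
  finally show ?thesis by simp
qed simp

section \<open>Integrals of one likelihood over the product space\<close>

locale prior = prob_space \<mu> for \<mu> :: "'x::topological_space measure" +
  assumes sets_prior[measurable_cong]: "sets \<mu> = sets borel"
begin

text \<open>Real values admit Bochner integrals and the real \<open>ln\<close>. An infinite evidence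
  is sent to \<open>0\<close>, which for a likelihood density happens only on a null set.\<close>

definition real_evidence :: "('x \<Rightarrow> 'y \<Rightarrow> real) \<Rightarrow> 'y \<Rightarrow> real"
  where "real_evidence f y = enn2real (evidence \<mu> f y)"

lemma real_evidence_nonneg: "0 \<le> real_evidence f y"
  by (simp add: real_evidence_def)

lemma pair_sigma_finite_lborel: "pair_sigma_finite (lborel :: 'y::euclidean_space measure) \<mu>"
  by (intro pair_sigma_finite.intro sigma_finite_lborel sigma_finite_measure_axioms)

context
  fixes f :: "'x \<Rightarrow> 'y::euclidean_space \<Rightarrow> real"
  assumes f: "likelihood_density f"
begin

interpretation pair: pair_sigma_finite "lborel :: 'y measure" \<mu>
  by (rule pair_sigma_finite_lborel)

lemma likelihood_nonneg: "0 \<le> f x y"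
  using f by (simp add: likelihood_density_def)

lemma measurable_likelihood:
  "(\<lambda>(y, x). f x y) \<in> borel_measurable ((lborel :: 'y measure) \<Otimes>\<^sub>M \<mu>)"
proof -
  have [measurable]: "(\<lambda>(x, y). f x y) \<in> borel_measurable (borel \<Otimes>\<^sub>M borel)"
    using f by (simp add: likelihood_density_def)
  have "(\<lambda>(x, y). f x y) \<circ> (\<lambda>(y, x). (x, y)) \<in> borel_measurable ((lborel :: 'y measure) \<Otimes>\<^sub>M \<mu>)"
    by (rule measurable_comp[where N = "borel \<Otimes>\<^sub>M borel"]) measurable
  then show ?thesis
    by (simp add: comp_def case_prod_unfold)
qed

lemma measurable_likelihood'[measurable]:
  "(\<lambda>z. f (snd z) (fst z)) \<in> borel_measurable ((lborel :: 'y measure) \<Otimes>\<^sub>M \<mu>)"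
  using measurable_likelihood by (simp add: case_prod_unfold)

lemma measurable_evidence[measurable]: "evidence \<mu> f \<in> borel_measurable borel"
proof -
  have "(\<lambda>(y, x). ennreal (f x y)) \<in> borel_measurable ((lborel :: 'y measure) \<Otimes>\<^sub>M \<mu>)"
    by (simp add: case_prod_unfold) measurable
  from borel_measurable_nn_integral_fst[OF this] show ?thesis
    by (simp add: evidence_def[abs_def])
qed

lemma measurable_real_evidence[measurable]: "real_evidence f \<in> borel_measurable borel"
  unfolding real_evidence_def[abs_def] by measurable

lemma nn_integral_likelihood: "(\<integral>\<^sup>+ z. f (snd z) (fst z) \<partial>(lborel \<Otimes>\<^sub>M \<mu>)) = 1"
proof -
  have "(\<integral>\<^sup>+ x. (\<integral>\<^sup>+ y. ennreal (f x y) \<partial>lborel) \<partial>\<mu>) = 1"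
    using f by (simp add: likelihood_density_def emeasure_space_1)
  then show ?thesis
    using pair.nn_integral_snd[of "\<lambda>z. ennreal (f (snd z) (fst z))"] by (simp add: case_prod_unfold)
qed

lemma integrable_likelihood: "integrable (lborel \<Otimes>\<^sub>M \<mu>) (\<lambda>z. f (snd z) (fst z))"
  using nn_integral_likelihood likelihood_nonneg by (intro integrableI_nonneg) auto

lemma integral_likelihood: "(\<integral> z. f (snd z) (fst z) \<partial>(lborel \<Otimes>\<^sub>M \<mu>)) = 1"
  using nn_integral_likelihood likelihood_nonneg by (simp add: integral_eq_nn_integral)

lemma nn_integral_evidence: "(\<integral>\<^sup>+ y. evidence \<mu> f y \<partial>lborel) = 1"
  using nn_integral_fst[of "\<lambda>z. ennreal (f (snd z) (fst z))" "lborel :: 'y measure"] nn_integral_likelihood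
  by (simp add: evidence_def)

lemma AE_evidence_finite: "AE y in lborel. evidence \<mu> f y \<noteq> \<infinity>"
  using nn_integral_evidence by (intro nn_integral_PInf_AE) auto

lemma nn_integral_real_evidence: "(\<integral>\<^sup>+ y. real_evidence f y \<partial>lborel) = 1"
proof -
  have "(\<integral>\<^sup>+ y. real_evidence f y \<partial>lborel) = (\<integral>\<^sup>+ y. evidence \<mu> f y \<partial>lborel)"
    using AE_evidence_finite by (intro nn_integral_cong_AE) (auto simp: real_evidence_def less_top)
  then show ?thesis by (simp add: nn_integral_evidence)
qed

text \<open>Where the evidence is zero, \<open>f x y\<close> vanishes for almost every
  \<open>x\<close>. Infinite evidence, which \<open>real_evidence\<close> also maps to
  \<open>0\<close>, occurs only for a null set of \<open>y\<close>.\<close>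

lemma AE_real_evidence_pos: "AE z in lborel \<Otimes>\<^sub>M \<mu>. f (snd z) (fst z) \<noteq> 0 \<longrightarrow> 0 < real_evidence f (fst z)"
proof (rule pair.AE_pair_measure)
  show "AE y in lborel. AE x in \<mu>. f (snd (y, x)) (fst (y, x)) \<noteq> 0 \<longrightarrow> 0 < real_evidence f (fst (y, x))"
    using AE_evidence_finite
  proof eventually_elim
    case (elim y)
    have m: "(\<lambda>x. f x y) \<in> borel_measurable \<mu>"
      using measurable_Pair2[OF measurable_likelihood, of y] by simp
    show ?case
    proof (cases "evidence \<mu> f y = 0")
      case True
      then have "AE x in \<mu>. ennreal (f x y) = 0"
        using m by (subst (asm) evidence_def, subst (asm) nn_integral_0_iff_AE) auto
      then show ?thesis
        by eventually_elim (use likelihood_nonneg in \<open>auto simp: antisym\<close>)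
    next
      case False
      with elim show ?thesis
        by (simp add: real_evidence_def enn2real_positive_iff less_top[symmetric] pos2 zero_less_iff_neq_zero)
    qed
  qed
qed measurable

text \<open>Integrating out \<open>x\<close> turns \<open>f\<close> into its evidence, which cancels
  the denominator. Equality can fail where \<open>real_evidence f y = 0\<close>: the quotient is
  \<open>0\<close> there while \<open>r y\<close> may be positive.\<close>

lemma nn_integral_likelihood_reweight:
  assumes [measurable]: "r \<in> borel_measurable borel" and "\<And>y. 0 \<le> r y"
  shows "(\<integral>\<^sup>+ z. f (snd z) (fst z) * (r (fst z) / real_evidence f (fst z)) \<partial>(lborel \<Otimes>\<^sub>M \<mu>)) \<le> (\<integral>\<^sup>+ y. r y \<partial>lborel)"
proof -
  have "(\<integral>\<^sup>+ z. f (snd z) (fst z) * (r (fst z) / real_evidence f (fst z)) \<partial>(lborel \<Otimes>\<^sub>M \<mu>))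
      = (\<integral>\<^sup>+ y. \<integral>\<^sup>+ x. ennreal (f x y * (r y / real_evidence f y)) \<partial>\<mu> \<partial>lborel)"
    by (subst nn_integral_fst[symmetric]) auto
  also have "\<dots> \<le> (\<integral>\<^sup>+ y. ennreal (r y) \<partial>lborel)"
  proof (rule nn_integral_mono)
    fix y
    have m: "(\<lambda>x. f x y) \<in> borel_measurable \<mu>"
      using measurable_Pair2[OF measurable_likelihood, of y] by simp
    have "(\<integral>\<^sup>+ x. ennreal (f x y * (r y / real_evidence f y)) \<partial>\<mu>) = evidence \<mu> f y * ennreal (r y / real_evidence f y)"
      using m assms(2)[of y] real_evidence_nonneg[of f y]
      by (simp add: ennreal_mult[OF likelihood_nonneg] evidence_def nn_integral_multc del: times_divide_eq_right)
    also have "\<dots> \<le> ennreal (r y)"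
    proof (cases "real_evidence f y = 0")
      case False
      then have "evidence \<mu> f y = ennreal (real_evidence f y)"
        by (auto simp: real_evidence_def ennreal_enn2real_if)
      with False real_evidence_nonneg[of f y] assms(2)[of y] show ?thesis
        by (simp add: ennreal_mult[symmetric])
    qed simp
    finally show "(\<integral>\<^sup>+ x. ennreal (f x y * (r y / real_evidence f y)) \<partial>\<mu>) \<le> ennreal (r y)" .
  qed
  finally show ?thesis .
qed

text \<open>Fubini's theorem: joint integrability makes the outer integral and almost every inner
  one finite, so no \<open>\<infinity> - \<infinity>\<close> arises.\<close>

lemma expected_utility_eq_integral:
  assumes int: "integrable (lborel \<Otimes>\<^sub>M \<mu>)
    (\<lambda>z. f (snd z) (fst z) * ln (f (snd z) (fst z) / real_evidence f (fst z)))"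
  shows "expected_utility \<mu> f = ereal (\<integral> z. f (snd z) (fst z) * ln (f (snd z) (fst z) / real_evidence f (fst z)) \<partial>(lborel \<Otimes>\<^sub>M \<mu>))"
proof -
  let ?F = "\<lambda>z. f (snd z) (fst z) * ln (f (snd z) (fst z) / real_evidence f (fst z))"
  have "AE y in lborel. ext_integral \<mu> (\<lambda>x. ext_ln (ennreal (f x y) / evidence \<mu> f y) * ereal (f x y))
      = ereal (\<integral> x. ?F (y, x) \<partial>\<mu>)"
    using AE_evidence_finite pair.AE_pair[OF AE_real_evidence_pos] pair.AE_integrable_fst'[OF int]
  proof eventually_elim
    case (elim y)
    from elim(2) have "AE x in \<mu>. ext_ln (ennreal (f x y) / evidence \<mu> f y) * ereal (f x y) = ereal (?F (y, x))"
    proof eventually_elim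
      case (elim x)
      show ?case
      proof (cases "f x y = 0")
        case False
        with elim likelihood_nonneg[of x y] have pos: "0 < f x y" "0 < real_evidence f y" by auto
        then have "evidence \<mu> f y = ennreal (real_evidence f y)"
          by (auto simp: real_evidence_def ennreal_enn2real_if)
        with pos show ?thesis
          by (simp add: ext_ln_def divide_ennreal mult.commute)
      qed (simp add: zero_ereal_def[symmetric])
    qed
    from ext_integral_cong_AE[OF this] elim(3) show ?case
      by (simp add: ext_integral_integrable)
  qed
  then have "expected_utility \<mu> f = ext_integral lborel (\<lambda>y. ereal (\<integral> x. ?F (y, x) \<partial>\<mu>))"
    unfolding expected_utility_def by (rule ext_integral_cong_AE)
  also have "\<dots> = ereal (integral\<^sup>L (lborel \<Otimes>\<^sub>M \<mu>) ?F)"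
    using pair.integrable_fst'[OF int] pair.integral_fst'[OF int] by (simp add: ext_integral_integrable)
  finally show ?thesis .
qed

text \<open>Where \<open>f\<close> or \<open>real_evidence f\<close> vanishes,
  \<open>ln 0 = 0\<close> makes the left integrand zero; elsewhere both squared logarithms agree.
  Passing from \<open>w\<close> to \<open>w'\<close> discards surplus terms of the moment
  bound.\<close>

lemma nn_integral_le_log_sq_moment:
  assumes [measurable]: "(\<lambda>z. w (snd z) (fst z)) \<in> borel_measurable ((lborel :: 'y measure) \<Otimes>\<^sub>M \<mu>)"
    and "\<And>x y. 0 \<le> w x y" "\<And>x y. w x y \<le> w' x y"
  shows "(\<integral>\<^sup>+ z. (ln (f (snd z) (fst z) / real_evidence f (fst z)))\<^sup>2 * w (snd z) (fst z) \<partial>(lborel \<Otimes>\<^sub>M \<mu>))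
    \<le> log_sq_moment \<mu> f w'"
proof -
  have bound: "ennreal ((ln (f x y / real_evidence f y))\<^sup>2 * w x y)
      \<le> e2ennreal ((ext_ln (ennreal (f x y) / evidence \<mu> f y))\<^sup>2) * ennreal (w' x y)" for x y
  proof (cases "f x y = 0 \<or> real_evidence f y = 0")
    case False
    with likelihood_nonneg[of x y] real_evidence_nonneg[of f y] have pos: "0 < f x y" "0 < real_evidence f y" by auto
    then have "evidence \<mu> f y = ennreal (real_evidence f y)"
      by (auto simp: real_evidence_def ennreal_enn2real_if)
    then have "e2ennreal ((ext_ln (ennreal (f x y) / evidence \<mu> f y))\<^sup>2) = ennreal ((ln (f x y / real_evidence f y))\<^sup>2)"
      using pos by (simp add: ext_ln_def divide_ennreal)
    then show ?thesis
      using assms(2,3) by (simp add: ennreal_mult mult_left_mono ennreal_leI)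
  qed auto
  have "(\<integral>\<^sup>+ z. (ln (f (snd z) (fst z) / real_evidence f (fst z)))\<^sup>2 * w (snd z) (fst z) \<partial>(lborel \<Otimes>\<^sub>M \<mu>))
      = (\<integral>\<^sup>+ y. \<integral>\<^sup>+ x. ennreal ((ln (f x y / real_evidence f y))\<^sup>2 * w x y) \<partial>\<mu> \<partial>lborel)"
    by (subst nn_integral_fst[symmetric]) auto
  also have "\<dots> \<le> log_sq_moment \<mu> f w'"
    unfolding log_sq_moment_def by (intro nn_integral_mono bound)
  finally show ?thesis .
qed

end

section \<open>Comparing the utilities of two likelihoods\<close>

text \<open>The summand \<open>K\<close> covers the expected divergence minus that of the evidences.
  The factor 2 comes from \<open>(sqrt G + sqrt F)^2 \<le> 2 * (F + G)\<close>.\<close>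

lemma abs_expected_utility_diff_le:
  fixes f g :: "'x::topological_space \<Rightarrow> 'y::euclidean_space \<Rightarrow> real"
  assumes f: "likelihood_density f" and g: "likelihood_density g"
    and KL: "(\<integral>\<^sup>+ x. KL_div (g x) (f x) \<partial>\<mu>) \<le> ennreal K" and "0 \<le> K"
    and moment: "log_sq_moment \<mu> f w \<le> ennreal V" and "0 \<le> V"
    and w: "\<And>x y. f x y + g x y \<le> w x y"
  shows "\<bar>expected_utility \<mu> f - expected_utility \<mu> g\<bar> \<le> ereal (K + sqrt K * sqrt (2 * V))"
proof -
  interpret pair: pair_sigma_finite "lborel :: 'y measure" \<mu>
    by (rule pair_sigma_finite_lborel)
  define M where "M = (lborel :: 'y measure) \<Otimes>\<^sub>M \<mu>"
  define F where "F = (\<lambda>z :: 'y \<times> 'x. f (snd z) (fst z))"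
  define G where "G = (\<lambda>z :: 'y \<times> 'x. g (snd z) (fst z))"
  define p where "p = (\<lambda>z :: 'y \<times> 'x. real_evidence f (fst z))"
  define q where "q = (\<lambda>z :: 'y \<times> 'x. real_evidence g (fst z))"
  note [measurable] = measurable_real_evidence[OF f] measurable_real_evidence[OF g]
  have [measurable]: "F \<in> borel_measurable M" "G \<in> borel_measurable M"
    using measurable_likelihood'[OF f] measurable_likelihood'[OF g] by (simp_all add: F_def G_def M_def)
  have [measurable]: "p \<in> borel_measurable M" "q \<in> borel_measurable M"
    unfolding p_def q_def M_def by measurable
  have nonneg: "0 \<le> F z" "0 \<le> G z" "0 \<le> p z" "0 \<le> q z" for z
    by (simp_all add: F_def G_def p_def q_def real_evidence_nonneg likelihood_nonneg[OF f] likelihood_nonneg[OF g])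
  have FG: "integrable M F" "integrable M G" "integral\<^sup>L M F = 1" "integral\<^sup>L M G = 1"
    using integrable_likelihood[OF f] integrable_likelihood[OF g]
      integral_likelihood[OF f] integral_likelihood[OF g]
    by (simp_all add: F_def G_def M_def)
  have p_pos: "AE z in M. F z \<noteq> 0 \<longrightarrow> 0 < p z" and q_pos: "AE z in M. G z \<noteq> 0 \<longrightarrow> 0 < q z"
    unfolding F_def G_def p_def q_def M_def by (fact AE_real_evidence_pos[OF f] AE_real_evidence_pos[OF g])+

  \<comment> \<open>Expected divergence\<close>
  define a where "a z = G z * ln (G z / F z)" for z
  \<comment> \<open>\<open>\<Phi>\<close> has the integral of \<open>a\<close>, as \<open>F\<close>
    and \<open>G\<close> both have mass 1, but is nonnegative almost everywhere; a bound on its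
    nonnegative integral therefore yields integrability of \<open>a\<close>.\<close>
  define \<Phi> where "\<Phi> z = a z - G z + F z" for z
  have [measurable]: "a \<in> borel_measurable M" "\<Phi> \<in> borel_measurable M"
    unfolding a_def[abs_def] \<Phi>_def[abs_def] by measurable
  have "(\<integral>\<^sup>+ z. (if F z = 0 \<and> G z \<noteq> 0 then \<infinity> else ennreal (\<Phi> z)) \<partial>M)
      = (\<integral>\<^sup>+ x. \<integral>\<^sup>+ y. (if F (y, x) = 0 \<and> G (y, x) \<noteq> 0 then \<infinity> else ennreal (\<Phi> (y, x))) \<partial>lborel \<partial>\<mu>)"
    unfolding M_def by (subst pair.nn_integral_snd) (auto simp: M_def[symmetric])
  also have "\<dots> \<le> (\<integral>\<^sup>+ x. KL_div (g x) (f x) \<partial>\<mu>)"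
  proof (rule nn_integral_mono)
    fix x assume x: "x \<in> space \<mu>"
    have "h x \<in> borel_measurable borel" "(\<integral>\<^sup>+ y. ennreal (h x y) \<partial>lborel) = 1"
      if h: "likelihood_density h" for h :: "'x \<Rightarrow> 'y \<Rightarrow> real"
    proof -
      show "h x \<in> borel_measurable borel"
        using measurable_Pair1[OF measurable_likelihood[OF h] x] by simp
    qed (use h in \<open>simp add: likelihood_density_def\<close>)
    with f g show "(\<integral>\<^sup>+ y. (if F (y, x) = 0 \<and> G (y, x) \<noteq> 0 then \<infinity> else ennreal (\<Phi> (y, x))) \<partial>lborel)
        \<le> KL_div (g x) (f x)"
      using nn_integral_le_KL_div[of "g x" "f x"]
      by (simp add: F_def G_def \<Phi>_def a_def likelihood_nonneg cong: if_cong)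
  qed
  also note KL
  finally have \<Phi>_le: "(\<integral>\<^sup>+ z. (if F z = 0 \<and> G z \<noteq> 0 then \<infinity> else ennreal (\<Phi> z)) \<partial>M) \<le> ennreal K" .
  \<comment> \<open>A finite integral leaves the value \<open>\<infinity>\<close> only on a null
    set, which gives absolute continuity jointly in both variables.\<close>
  then have "AE z in M. (if F z = 0 \<and> G z \<noteq> 0 then \<infinity> else ennreal (\<Phi> z)) \<noteq> \<infinity>"
    by (intro nn_integral_PInf_AE) (auto simp: top_unique)
  then have supp: "AE z in M. F z = 0 \<longrightarrow> G z = 0"
    by eventually_elim (auto split: if_splits)
  have \<Phi>_nonneg: "AE z in M. 0 \<le> \<Phi> z"
    using supp
  proof eventually_elim
    case (elim z)
    then show ?case
      using mult_ln_div_ge[of "G z" "F z"] nonneg[of z] by (auto simp: \<Phi>_def a_def)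
  qed
  have "(\<integral>\<^sup>+ z. \<Phi> z \<partial>M) = (\<integral>\<^sup>+ z. (if F z = 0 \<and> G z \<noteq> 0 then \<infinity> else ennreal (\<Phi> z)) \<partial>M)"
    using supp by (intro nn_integral_cong_AE) auto
  with \<Phi>_le have \<Phi>_le': "(\<integral>\<^sup>+ z. \<Phi> z \<partial>M) \<le> ennreal K" by simp
  have int_of_bound: "integrable M h" "integral\<^sup>L M h \<le> c"
    if "h \<in> borel_measurable M" "AE z in M. 0 \<le> h z" "(\<integral>\<^sup>+ z. h z \<partial>M) \<le> ennreal c" "0 \<le> c" for h c
  proof -
    show int: "integrable M h"
      using that by (intro integrableI_nonneg) (auto intro: le_less_trans)
    show "integral\<^sup>L M h \<le> c"
      using that nn_integral_eq_integral[OF int] by simp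
  qed
  have \<Phi>: "integrable M \<Phi>" "integral\<^sup>L M \<Phi> \<le> K"
    using \<Phi>_nonneg \<Phi>_le' \<open>0 \<le> K\<close> by (auto intro!: int_of_bound)
  have a_eq: "a = (\<lambda>z. \<Phi> z + G z - F z)"
    by (auto simp: \<Phi>_def)
  have a: "integrable M a" "integral\<^sup>L M a = integral\<^sup>L M \<Phi>"
    using \<Phi> FG by (simp_all add: a_eq)

  \<comment> \<open>Moments of the logarithm\<close>
  define L where "L z = ln (F z / p z)" for z
  have [measurable]: "L \<in> borel_measurable M"
    unfolding L_def[abs_def] by measurable
  define m where "m z = (L z)\<^sup>2 * (F z + G z)" for z
  have [measurable]: "m \<in> borel_measurable M"
    unfolding m_def[abs_def] by measurable
  have "(\<integral>\<^sup>+ z. m z \<partial>M) \<le> log_sq_moment \<mu> f w"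
    using nn_integral_le_log_sq_moment[OF f, of "\<lambda>x y. f x y + g x y" w] w
      likelihood_nonneg[OF f] likelihood_nonneg[OF g] measurable_likelihood'[OF f] measurable_likelihood'[OF g]
    by (simp add: m_def L_def F_def G_def p_def M_def)
  with moment have "(\<integral>\<^sup>+ z. m z \<partial>M) \<le> ennreal V" by (rule order_trans[rotated])
  then have m: "integrable M m" "integral\<^sup>L M m \<le> V"
    using nonneg \<open>0 \<le> V\<close> by (auto intro!: int_of_bound simp: m_def)
  \<comment> \<open>\<open>\<bar>L z\<bar> \<le> 1 + (L z)^2\<close> trades a first moment for mass
    plus second moment; it serves with \<open>c = F z\<close> and \<open>c = G z\<close>.\<close>
  have L_bound: "\<bar>c * L z\<bar> \<le> c + m z" if "0 \<le> c" "c \<le> F z + G z" for c z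
  proof -
    have "\<bar>L z\<bar> \<le> 1 + (L z)\<^sup>2"
      using sum_squares_bound[of 1 "\<bar>L z\<bar>"] by (simp add: power2_eq_square)
    then have "c * \<bar>L z\<bar> \<le> c * (1 + (L z)\<^sup>2)"
      using that by (intro mult_left_mono)
    also have "\<dots> \<le> c + m z"
      using mult_right_mono[OF that(2), of "(L z)\<^sup>2"] by (simp add: m_def algebra_simps)
    finally show ?thesis using that by (simp add: abs_mult)
  qed
  have FL: "integrable M (\<lambda>z. F z * L z)"
  proof (rule Bochner_Integration.integrable_bound)
    show "integrable M (\<lambda>z. F z + m z)"
      using FG m by simp
    show "AE z in M. norm (F z * L z) \<le> norm (F z + m z)"
      unfolding real_norm_def using nonneg by (intro AE_I2 order_trans[OF L_bound abs_ge_self]) auto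
  qed measurable
  have GL: "integrable M (\<lambda>z. G z * L z)"
  proof (rule Bochner_Integration.integrable_bound)
    show "integrable M (\<lambda>z. G z + m z)"
      using FG m by simp
    show "AE z in M. norm (G z * L z) \<le> norm (G z + m z)"
      unfolding real_norm_def using nonneg by (intro AE_I2 order_trans[OF L_bound abs_ge_self]) auto
  qed measurable

  \<comment> \<open>Divergence of the evidences\<close>
  \<comment> \<open>Comparison densities of mass at most 1. Where all terms are positive,
    \<open>G / k = q / p\<close> and \<open>G / h\<close> is \<open>G / F\<close> divided by
    \<open>q / p\<close>, so \<open>k\<close> bounds \<open>b\<close> from below and
    \<open>h\<close> from above.\<close>
  define h where "h z = F z * (q z / p z)" for z
  define k where "k z = G z * (p z / q z)" for z
  have [measurable]: "h \<in> borel_measurable M" "k \<in> borel_measurable M"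
    unfolding h_def[abs_def] k_def[abs_def] by measurable
  have "(\<integral>\<^sup>+ z. h z \<partial>M) \<le> ennreal 1" "(\<integral>\<^sup>+ z. k z \<partial>M) \<le> ennreal 1"
    using nn_integral_likelihood_reweight[OF f, of "real_evidence g"] nn_integral_real_evidence[OF g]
      nn_integral_likelihood_reweight[OF g, of "real_evidence f"] nn_integral_real_evidence[OF f]
    by (simp_all add: real_evidence_nonneg h_def k_def F_def G_def p_def q_def M_def)
  then have h: "integrable M h" "integral\<^sup>L M h \<le> 1" and k: "integrable M k" "integral\<^sup>L M k \<le> 1"
    using nonneg int_of_bound[of h 1] int_of_bound[of k 1] by (auto simp: h_def k_def)

  \<comment> \<open>Integrating out \<open>x\<close> turns \<open>G\<close> into \<open>q\<close>,
    so the integral of \<open>b\<close> is the divergence of the evidences.\<close>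
  define b where "b z = G z * ln (q z / p z)" for z
  have [measurable]: "b \<in> borel_measurable M"
    unfolding b_def[abs_def] by measurable
  \<comment> \<open>Both bounds are \<open>log t \<ge> 1 - 1/t\<close>: for the lower one \<open>t = q/p\<close>, for the upper one \<open>t = g p / (f q)\<close>.\<close>
  have b_bounds: "AE z in M. G z - k z \<le> b z \<and> b z \<le> a z - G z + h z"
    using supp p_pos q_pos
  proof eventually_elim
    case (elim z)
    show ?case
    proof (cases "G z = 0")
      case True
      then show ?thesis using nonneg[of z] by (simp add: b_def k_def a_def h_def)
    next
      case False
      with elim nonneg[of z] have pos: "0 < G z" "0 < F z" "0 < p z" "0 < q z"
        by (auto simp: less_le)
      have "ln (G z / k z) = ln (q z / p z)"
        using pos by (simp add: k_def)
      moreover have "ln (G z / h z) = ln (G z / F z) - ln (q z / p z)"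
        using pos by (simp add: h_def ln_div ln_mult)
      ultimately show ?thesis
        using mult_ln_div_ge[of "G z" "k z"] mult_ln_div_ge[of "G z" "h z"] pos
        by (simp add: b_def a_def right_diff_distrib) (simp add: k_def h_def)
    qed
  qed
  have b: "integrable M b"
  proof (rule Bochner_Integration.integrable_bound)
    show "integrable M (\<lambda>z. \<bar>G z - k z\<bar> + \<bar>a z - G z + h z\<bar>)"
      using FG h k a by simp
    show "AE z in M. norm (b z) \<le> norm (\<bar>G z - k z\<bar> + \<bar>a z - G z + h z\<bar>)"
      using b_bounds by eventually_elim auto
  qed measurable
  have "integral\<^sup>L M (\<lambda>z. G z - k z) \<le> integral\<^sup>L M b"
    by (rule integral_mono_AE) (use b_bounds FG k b in auto)
  then have b_nonneg: "0 \<le> integral\<^sup>L M b"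
    using FG k by simp
  have "integral\<^sup>L M b \<le> integral\<^sup>L M (\<lambda>z. a z - G z + h z)"
    by (rule integral_mono_AE) (use b_bounds FG h a b in auto)
  then have b_le: "integral\<^sup>L M b \<le> integral\<^sup>L M a"
    using FG h a by simp

  \<comment> \<open>Decomposition of the surrogate utility\<close>
  \<comment> \<open>Where \<open>G z \<noteq> 0\<close>, all four quantities are positive and
    \<open>ln (G / q)\<close> telescopes into
    \<open>ln (G / F) - ln (q / p) + ln (F / p)\<close>.\<close>
  have e_eq: "AE z in M. G z * ln (G z / q z) = a z - b z + G z * L z"
    using supp p_pos q_pos
  proof eventually_elim
    case (elim z)
    show ?case
    proof (cases "G z = 0")
      case False
      with elim nonneg[of z] have "0 < G z" "0 < F z" "0 < p z" "0 < q z"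
        by (auto simp: less_le)
      then show ?thesis
        by (simp add: a_def b_def L_def ln_div algebra_simps)
    qed (simp add: a_def b_def)
  qed
  have rhs: "integrable M (\<lambda>z. a z - b z + G z * L z)"
    using a b GL by simp
  have e: "integrable M (\<lambda>z. G z * ln (G z / q z))"
    by (subst integrable_cong_AE[OF _ _ e_eq]) (use rhs in auto)
  have Ug: "expected_utility \<mu> g = ereal (integral\<^sup>L M a - integral\<^sup>L M b + (\<integral> z. G z * L z \<partial>M))"
  proof -
    have "expected_utility \<mu> g = ereal (\<integral> z. G z * ln (G z / q z) \<partial>M)"
      using expected_utility_eq_integral[OF g] e by (simp add: G_def q_def M_def)
    also have "(\<integral> z. G z * ln (G z / q z) \<partial>M) = (\<integral> z. a z - b z + G z * L z \<partial>M)"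
      by (rule integral_cong_AE[OF _ _ e_eq]) auto
    finally show ?thesis
      using a b GL by simp
  qed
  have Uf: "expected_utility \<mu> f = ereal (\<integral> z. F z * L z \<partial>M)"
    using expected_utility_eq_integral[OF f] FL by (simp add: F_def L_def p_def M_def)

  \<comment> \<open>Hellinger bound for the remainder\<close>
  define u where "u z = sqrt (G z) - sqrt (F z)" for z
  define v where "v z = (sqrt (G z) + sqrt (F z)) * L z" for z
  have [measurable]: "u \<in> borel_measurable M" "v \<in> borel_measurable M"
    unfolding u_def[abs_def] v_def[abs_def] by measurable
  have u_le: "AE z in M. (u z)\<^sup>2 \<le> \<Phi> z"
    using supp
  proof eventually_elim
    case (elim z)
    then show ?case
      using sqrt_diff_sq_le_mult_ln_div[of "G z" "F z"] nonneg[of z] by (auto simp: u_def \<Phi>_def a_def)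
  qed
  have v_le: "(v z)\<^sup>2 \<le> 2 * m z" for z
  proof -
    have "(sqrt (G z) + sqrt (F z))\<^sup>2 \<le> 2 * (F z + G z)"
      using sum_squares_bound[of "sqrt (G z)" "sqrt (F z)"] nonneg[of z] by (simp add: power2_sum)
    from mult_right_mono[OF this, of "(L z)\<^sup>2"] show ?thesis
      by (simp add: v_def m_def power_mult_distrib mult_ac del: distrib_left_numeral distrib_right_numeral)
  qed
  have u: "integrable M (\<lambda>z. (u z)\<^sup>2)"
    by (rule Bochner_Integration.integrable_bound[OF \<Phi>(1)]) (use u_le in auto)
  have v: "integrable M (\<lambda>z. (v z)\<^sup>2)"
  proof (rule Bochner_Integration.integrable_bound)
    show "integrable M (\<lambda>z. 2 * m z)"
      using m by simp
    show "AE z in M. norm ((v z)\<^sup>2) \<le> norm (2 * m z)"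
      by (intro AE_I2) (use v_le in \<open>simp add: order_trans[OF _ abs_ge_self]\<close>)
  qed measurable
  have "(\<integral> z. (u z)\<^sup>2 \<partial>M) \<le> K"
    using integral_mono_AE[OF u \<Phi>(1) u_le] \<Phi>(2) by linarith
  moreover have "(\<integral> z. (v z)\<^sup>2 \<partial>M) \<le> (\<integral> z. 2 * m z \<partial>M)"
    by (rule integral_mono[OF v]) (use m v_le in auto)
  then have "(\<integral> z. (v z)\<^sup>2 \<partial>M) \<le> 2 * V"
    using m(2) by simp
  ultimately have "\<bar>\<integral> z. u z * v z \<partial>M\<bar> \<le> sqrt K * sqrt (2 * V)"
    by (intro order_trans[OF Cauchy_Schwarz_integral[OF _ _ u v]] mult_mono)
      (use \<open>0 \<le> K\<close> in auto)
  moreover have "u z * v z = G z * L z - F z * L z" for z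
    using nonneg[of z] by (simp add: u_def v_def algebra_simps)
  then have "(\<integral> z. u z * v z \<partial>M) = (\<integral> z. G z * L z \<partial>M) - (\<integral> z. F z * L z \<partial>M)"
    using FL GL by simp
  \<comment> \<open>The utility of \<open>g\<close> minus that of \<open>f\<close> is the integral
    of \<open>a\<close> minus that of \<open>b\<close>, which lies between \<open>0\<close> and
    \<open>K\<close>, plus the integral of \<open>u * v\<close>.\<close>
  ultimately show ?thesis
    using b_nonneg b_le a(2) \<Phi>(2) by (simp add: Uf Ug)
qed

end

section \<open>Uniform convergence rate\<close>

theorem theorem3p4:
  fixes \<mu>0 :: "'x::banach measure"
    and \<pi> :: "'d::metric_space \<Rightarrow> 'x \<Rightarrow> real ^ 'p \<Rightarrow> real"
    and \<pi>N :: "nat \<Rightarrow> 'd \<Rightarrow> 'x \<Rightarrow> real ^ 'p \<Rightarrow> real"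
    and \<psi> :: "nat \<Rightarrow> real"
    and C0 C1 :: real
  assumes "separable_space (euclidean :: 'x topology)"
    and "prob_space \<mu>0" and "sets \<mu>0 = sets borel"
    and "\<And>d. likelihood_density (\<pi> d)"
    and "\<And>N d. likelihood_density (\<pi>N N d)"
    and "C1 > 0" and "\<And>N. \<psi> N \<ge> 0" and "\<psi> \<longlonglongrightarrow> 0"
    and A1: "\<And>d N. (\<integral>\<^sup>+ x. KL_div (\<pi>N N d x) (\<pi> d x) \<partial>\<mu>0) \<le> ennreal (C1 * \<psi> N)"
    and "C0 > 0"
    and A3: "\<And>N d s. s \<longlonglongrightarrow> d \<Longrightarrow>
      log_sq_moment \<mu>0 (\<pi> d) (\<lambda>x y. \<pi> d x y + \<pi>N N d x y + \<pi> (s N) x y) < ennreal C0"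
  shows "\<exists>C>0. \<forall>\<^sub>F N in sequentially.
    (SUP d. \<bar>expected_utility \<mu>0 (\<pi> d) - expected_utility \<mu>0 (\<pi>N N d)\<bar>) \<le> ereal (C * sqrt (\<psi> N))"
proof -
  have "prior \<mu>0"
    using assms(2,3) by (simp add: prior_def prior_axioms_def)
  \<comment> \<open>The pairwise bound with \<open>K = C1 * \<psi> N\<close> and
    \<open>V = C0\<close>, after \<open>\<psi> N \<le> sqrt (\<psi> N)\<close>, which holds once
    \<open>\<psi> N < 1\<close>.\<close>
  define C where "C = C1 + sqrt C1 * sqrt (2 * C0)"
  have "\<bar>expected_utility \<mu>0 (\<pi> d) - expected_utility \<mu>0 (\<pi>N N d)\<bar> \<le> ereal (C * sqrt (\<psi> N))"
    if "\<psi> N < 1" for N d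
  proof -
    \<comment> \<open>(A3) along the constant sequence \<open>d\<close>; its weight dominates the
      sum of the two densities.\<close>
    let ?w = "\<lambda>x y. \<pi> d x y + \<pi>N N d x y + \<pi> d x y"
    have "log_sq_moment \<mu>0 (\<pi> d) ?w \<le> ennreal C0"
      using A3[of "\<lambda>_. d" d N] by simp
    then have "\<bar>expected_utility \<mu>0 (\<pi> d) - expected_utility \<mu>0 (\<pi>N N d)\<bar>
        \<le> ereal (C1 * \<psi> N + sqrt (C1 * \<psi> N) * sqrt (2 * C0))"
      using assms(4-7,10) A1 \<open>prior \<mu>0\<close> prior.likelihood_nonneg[OF \<open>prior \<mu>0\<close> assms(4)]
      by (intro prior.abs_expected_utility_diff_le[where w = ?w]) auto
    also have "C1 * \<psi> N + sqrt (C1 * \<psi> N) * sqrt (2 * C0) \<le> C * sqrt (\<psi> N)"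
    proof -
      have "\<psi> N = sqrt (\<psi> N) * sqrt (\<psi> N)"
        using assms(7) by simp
      also have "\<dots> \<le> sqrt (\<psi> N)"
        using assms(7)[of N] that by (intro mult_left_le) auto
      finally have "C1 * \<psi> N \<le> C1 * sqrt (\<psi> N)"
        using assms(6) by simp
      then show ?thesis
        by (simp add: C_def real_sqrt_mult algebra_simps)
    qed
    finally show ?thesis by simp
  qed
  \<comment> \<open>This threshold does not involve \<open>d\<close>, so the bound passes to the
    supremum.\<close>
  moreover have "\<forall>\<^sub>F N in sequentially. \<psi> N < 1"
    using assms(8) by (rule order_tendstoD) simp
  ultimately have "\<forall>\<^sub>F N in sequentially.
      (SUP d. \<bar>expected_utility \<mu>0 (\<pi> d) - expected_utility \<mu>0 (\<pi>N N d)\<bar>) \<le> ereal (C * sqrt (\<psi> N))"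
    by (auto elim!: eventually_mono intro!: SUP_least)
  moreover have "C > 0"
    using assms(6,10) by (simp add: C_def add_pos_nonneg)
  ultimately show ?thesis by blast
qed

end
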